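(* Let $\mathcal{X}$ be a finite set, $\pi$ a probability mass function on $\mathcal{X}$ with $\min_x\pi(x)>0$, $M \in \mathcal{M}$, $Q \in \mathcal{I}(\pi) \cap \mathcal{L}$ and $N \in \mathcal{M}(\pi,Q)$. Let $\overline{M}(Q):=\frac12(M+QMQ)$. Then $$ \|M - N\|_F^2 = \|M - \overline{M}(Q)\|_F^2 + \|\overline{M}(Q) - N\|_F^2. $$ In particular, $\overline{M}(Q)$ is the unique projection of $M$ onto $\mathcal{M}(\pi,Q)$ under the squared-Frobenius norm, i.e. the unique minimizer of $N\mapsto\|M-N\|_F^2$ over $N \in \mathcal{M}(\pi,Q)$.
   Context: $\mathcal{M}$ is the space of real matrices indexed by $\mathcal{X}\times\mathcal{X}$; for $M\in\mathcal{M}$, $M^*(x,y):=\frac{\pi(y)}{\pi(x)}M(y,x)$ is the $\ell^2(\pi)$-adjoint. The Frobenius inner product is $\langle M,N\rangle_F:=\mathrm{Tr}(M^*N)$, with norm $\|M\|_F=\sqrt{\langle M,M\rangle_F}$. $\mathcal{L}$ is the set of transition (row-stochastic) matrices on $\mathcal{X}$, $\mathcal{I}(\pi)$ is the set of matrices $Q\in\mathcal{M}$ with $Q^2=I$ and $Q^*=Q$, and $\mathcal{M}(\pi,Q):=\{M\in\mathcal{M}: M=QMQ\}$. *)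

theory Defs
  imports "HOL-Analysis.Analysis" "HOL-Probability.Probability_Mass_Function"
begin

definition weighted_adjoint :: "'x::finite pmf \<Rightarrow> real^'x^'x \<Rightarrow> real^'x^'x" where
  "weighted_adjoint \<pi> M = (\<chi> x y. pmf \<pi> y / pmf \<pi> x * M $ y $ x)"

(* For non-uniform \<pi> this differs from the library inner product on real^'x^'x,
   which is the unweighted one; likewise for frob_norm and norm. *)
definition frob_inner :: "'x::finite pmf \<Rightarrow> real^'x^'x \<Rightarrow> real^'x^'x \<Rightarrow> real" where
  "frob_inner \<pi> M N = trace (weighted_adjoint \<pi> M ** N)"

definition frob_norm :: "'x::finite pmf \<Rightarrow> real^'x^'x \<Rightarrow> real" where
  "frob_norm \<pi> M = sqrt (frob_inner \<pi> M M)"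

definition transition_matrices :: "(real^'x^'x::finite) set" where
  "transition_matrices = {P. (\<forall>x y. 0 \<le> P $ x $ y) \<and> (\<forall>x. (\<Sum>y\<in>UNIV. P $ x $ y) = 1)}"

definition isometric_involutions :: "'x::finite pmf \<Rightarrow> (real^'x^'x) set" where
  "isometric_involutions \<pi> = {Q. Q ** Q = mat 1 \<and> weighted_adjoint \<pi> Q = Q}"

(* Usually written M(\<pi>, Q); the condition itself involves only Q. *)
definition invariant_matrices :: "real^'x^'x \<Rightarrow> (real^'x^'x::finite) set" where
  "invariant_matrices Q = {M. M = Q ** M ** Q}"

definition group_average :: "real^'x^'x \<Rightarrow> real^'x^'x \<Rightarrow> real^'x^'x::finite" where
  "group_average Q M = (1/2) *\<^sub>R (M + Q ** M ** Q)"

end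

theory Submission
  imports Defs
begin

text \<open>
  Conjugation by \<open>Q\<close> is a linear involution of the matrix space, and because \<open>Q\<close> is self-adjoint it
  is an isometry for the weighted Frobenius product. Its eigenspaces for the eigenvalues \<open>1\<close> and
  \<open>-1\<close> are therefore orthogonal; \<open>group_average Q M - N\<close> lies in the first and
  \<open>M - group_average Q M\<close> in the second, so the identity is Pythagoras' theorem.
\<close>

text \<open>The transposition in the adjoint pairs each entry with the same entry of the other
  matrix, so symmetry, linearity and positivity can be read off termwise.\<close>

lemma frob_inner_eq_sum:
  "frob_inner \<pi> M N = (\<Sum>x\<in>UNIV. \<Sum>y\<in>UNIV. pmf \<pi> y / pmf \<pi> x * (M $ y $ x * N $ y $ x))"
  by (simp add: frob_inner_def weighted_adjoint_def trace_def matrix_matrix_mult_def mult.assoc)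

lemma frob_inner_add_left: "frob_inner \<pi> (A + B) C = frob_inner \<pi> A C + frob_inner \<pi> B C"
  by (simp add: frob_inner_eq_sum algebra_simps sum.distrib)

lemma frob_inner_uminus_left: "frob_inner \<pi> (- A) C = - frob_inner \<pi> A C"
  by (simp add: frob_inner_eq_sum sum_negf)

lemma frob_inner_commute: "frob_inner \<pi> A B = frob_inner \<pi> B A"
  by (simp add: frob_inner_eq_sum mult.commute)

lemma frob_inner_self_nonneg: "0 \<le> frob_inner \<pi> A A"
  by (simp add: frob_inner_eq_sum sum_nonneg)

lemma frob_norm_power2: "(frob_norm \<pi> A)\<^sup>2 = frob_inner \<pi> A A"
  by (simp add: frob_norm_def frob_inner_self_nonneg)

text \<open>A sum of squares with strictly positive weights vanishes only termwise. Uniqueness of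
  the minimizer rests on this.\<close>

lemma frob_inner_self_eq_0_iff:
  assumes "\<And>x. 0 < pmf \<pi> x"
  shows "frob_inner \<pi> A A = 0 \<longleftrightarrow> A = 0"
  using assms
  by (simp add: frob_inner_eq_sum sum_nonneg_eq_0_iff sum_nonneg less_imp_neq[symmetric] vec_eq_iff)
    blast

lemma frob_norm_power2_add:
  assumes "frob_inner \<pi> A B = 0"
  shows "(frob_norm \<pi> (A + B))\<^sup>2 = (frob_norm \<pi> A)\<^sup>2 + (frob_norm \<pi> B)\<^sup>2"
  using assms
  by (simp add: frob_norm_power2 frob_inner_add_left
      frob_inner_commute[of \<pi> A "A + B"] frob_inner_commute[of \<pi> B "A + B"]
      frob_inner_commute[of \<pi> B A])

text \<open>The weights telescope through the summation index \<open>z\<close>: the factor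
  \<open>pmf \<pi> z\<close> enters once in a numerator and once in a denominator, and positivity
  lets it cancel.\<close>

lemma weighted_adjoint_mult:
  assumes "\<And>x. 0 < pmf \<pi> x"
  shows "weighted_adjoint \<pi> (A ** B) = weighted_adjoint \<pi> B ** weighted_adjoint \<pi> A"
  using assms
  by (simp add: weighted_adjoint_def matrix_matrix_mult_def vec_eq_iff sum_distrib_left
      less_imp_neq[symmetric] mult_ac)

lemma frob_inner_conjugate:
  assumes "\<And>x. 0 < pmf \<pi> x" and "Q \<in> isometric_involutions \<pi>"
  shows "frob_inner \<pi> (Q ** A ** Q) (Q ** B ** Q) = frob_inner \<pi> A B"
proof -
  have Q: "Q ** Q = mat 1" "weighted_adjoint \<pi> Q = Q"
    using assms(2) by (auto simp: isometric_involutions_def)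
  have "weighted_adjoint \<pi> (Q ** A ** Q) ** (Q ** B ** Q)
      = Q ** (weighted_adjoint \<pi> A ** (Q ** Q) ** B ** Q)"
    by (simp add: weighted_adjoint_mult[OF assms(1)] Q(2) matrix_mul_assoc)
  \<comment> \<open>Cyclicity of the trace carries the leading \<open>Q\<close> to the end, where it
    meets the last one; both pairs then cancel by \<open>Q ** Q = mat 1\<close>.\<close>
  also have "trace \<dots> = trace (weighted_adjoint \<pi> A ** B ** (Q ** Q))"
    by (subst trace_mul_sym) (simp add: Q(1) matrix_mul_assoc[symmetric])
  finally show ?thesis
    by (simp add: frob_inner_def Q(1))
qed

lemma conjugate_involutive:
  assumes "Q ** Q = mat 1"
  shows "Q ** (Q ** A ** Q) ** Q = A"
  using assms by (metis matrix_mul_assoc matrix_mul_lid matrix_mul_rid)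

lemma conjugate_add: "Q ** (A + B) ** Q = Q ** A ** Q + Q ** B ** Q"
  for Q :: "real^'x^'x"
  by (simp add: matrix_matrix_mult_def vec_eq_iff algebra_simps sum.distrib)

lemma conjugate_diff: "Q ** (A - B) ** Q = Q ** A ** Q - Q ** B ** Q"
  for Q :: "real^'x^'x"
  using conjugate_add[of Q "A - B" B] by simp

lemma conjugate_scaleR: "Q ** (c *\<^sub>R A) ** Q = c *\<^sub>R (Q ** A ** Q)"
  for Q :: "real^'x^'x"
  by (simp add: matrix_scalar_ac scalar_matrix_assoc)

text \<open>Conjugation by \<open>Q\<close> swaps the two summands \<open>M\<close> and
  \<open>Q ** M ** Q\<close>.\<close>

lemma group_average_invariant:
  assumes "Q ** Q = mat 1"
  shows "group_average Q M \<in> invariant_matrices Q"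
  by (simp add: invariant_matrices_def group_average_def conjugate_scaleR conjugate_add
      conjugate_involutive[OF assms] add.commute)

text \<open>Conjugating both arguments preserves the product but flips the sign of the first
  argument only, so the product equals its own negative.\<close>

lemma group_average_orthogonal:
  assumes "\<And>x. 0 < pmf \<pi> x" and "Q \<in> isometric_involutions \<pi>" and "N \<in> invariant_matrices Q"
  shows "frob_inner \<pi> (M - group_average Q M) (group_average Q M - N) = 0"
proof -
  let ?G = "group_average Q M"
  have Q: "Q ** Q = mat 1"
    using assms(2) by (simp add: isometric_involutions_def)
  have G: "Q ** ?G ** Q = ?G"
    using group_average_invariant[OF Q, of M] by (simp add: invariant_matrices_def)
  \<comment> \<open>This replaces \<open>Q ** M ** Q\<close> by \<open>?G + ?G - M\<close>, so that
    conjugation sends \<open>M - ?G\<close> to \<open>?G - M\<close>.\<close>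
  have "M + Q ** M ** Q = ?G + ?G"
    by (simp add: group_average_def flip: scaleR_left_distrib)
  then have "Q ** (M - ?G) ** Q = - (M - ?G)"
    by (simp add: conjugate_diff G algebra_simps)
  moreover have "Q ** (?G - N) ** Q = ?G - N"
    using assms(3) by (simp add: conjugate_diff G invariant_matrices_def)
  ultimately show ?thesis
    using frob_inner_conjugate[OF assms(1,2), of "M - ?G" "?G - N"]
      frob_inner_uminus_left[of \<pi> "M - ?G" "?G - N"]
    by simp
qed

theorem proposition2p4:
  fixes \<pi> :: "'x::finite pmf" and M Q :: "real^'x^'x"
  assumes "0 < (MIN x. pmf \<pi> x)"
    and "Q \<in> isometric_involutions \<pi> \<inter> transition_matrices"
  shows "(\<forall>N \<in> invariant_matrices Q.
            (frob_norm \<pi> (M - N))\<^sup>2 =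
              (frob_norm \<pi> (M - group_average Q M))\<^sup>2 + (frob_norm \<pi> (group_average Q M - N))\<^sup>2)
       \<and> is_arg_min (\<lambda>N. (frob_norm \<pi> (M - N))\<^sup>2) (\<lambda>N. N \<in> invariant_matrices Q) (group_average Q M)
       \<and> (\<forall>P. is_arg_min (\<lambda>N. (frob_norm \<pi> (M - N))\<^sup>2) (\<lambda>N. N \<in> invariant_matrices Q) P
               \<longrightarrow> P = group_average Q M)"
proof -
  let ?G = "group_average Q M"
  have pos: "0 < pmf \<pi> x" for x
    using assms(1) by simp
  have Q: "Q \<in> isometric_involutions \<pi>"
    using assms(2) by blast
  have G: "?G \<in> invariant_matrices Q"
    using Q by (simp add: isometric_involutions_def group_average_invariant)
  have pyth: "(frob_norm \<pi> (M - N))\<^sup>2 = (frob_norm \<pi> (M - ?G))\<^sup>2 + (frob_norm \<pi> (?G - N))\<^sup>2"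
    if "N \<in> invariant_matrices Q" for N
    \<comment> \<open>The two orthogonal pieces \<open>M - ?G\<close> and \<open>?G - N\<close> add
      up to \<open>M - N\<close>.\<close>
    using frob_norm_power2_add[OF group_average_orthogonal[OF pos Q that, of M]] by simp
  have "is_arg_min (\<lambda>N. (frob_norm \<pi> (M - N))\<^sup>2) (\<lambda>N. N \<in> invariant_matrices Q) ?G"
    unfolding is_arg_min_linorder
  proof (intro conjI allI impI G)
    fix N assume "N \<in> invariant_matrices Q"
    then show "(frob_norm \<pi> (M - ?G))\<^sup>2 \<le> (frob_norm \<pi> (M - N))\<^sup>2"
      by (subst pyth) simp_all
  qed
  moreover have "P = ?G"
    if P: "is_arg_min (\<lambda>N. (frob_norm \<pi> (M - N))\<^sup>2) (\<lambda>N. N \<in> invariant_matrices Q) P" for P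
  proof -
    have "P \<in> invariant_matrices Q" "(frob_norm \<pi> (M - P))\<^sup>2 \<le> (frob_norm \<pi> (M - ?G))\<^sup>2"
      using P G by (auto simp: is_arg_min_linorder)
    \<comment> \<open>By the identity at \<open>P\<close>, this square is exactly the excess of the
      objective at \<open>P\<close> over its value at \<open>?G\<close>, which minimality of
      \<open>P\<close> forbids from being positive.\<close>
    then have "(frob_norm \<pi> (?G - P))\<^sup>2 \<le> 0"
      using pyth[of P] by linarith
    then have "frob_inner \<pi> (?G - P) (?G - P) = 0"
      using frob_inner_self_nonneg[of \<pi> "?G - P"] by (simp add: frob_norm_power2)
    then show ?thesis
      by (simp add: frob_inner_self_eq_0_iff[OF pos])
  qed
  ultimately show ?thesis
    using pyth by blast
qed

end
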